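(* Let $n\in\mathbb{N}$, let $f=((f_1^-,f_1^+),\dots,(f_n^-,f_n^+))\in\mathcal{B}_2^n$, and let $V\subset\mathbb{R}^n$ be closed. Then there exist a closed set $G=G^1\times\cdots\times G^n\subset\mathbb{R}^n$ with $0\in G$ and $c=(c_1,\dots,c_n)\in[0,1]^n$ such that $$\sup_{X\in\mathcal{T}_2(f)}P(X\in V)=P\big(\mathscr{S}_2(f,G,c)\in V\big).$$
   Context: $(0,1)^n$ carries Lebesgue measure on the Borel $\sigma$-algebra, which is the probability measure $P$ for random variables with domain $(0,1)^n$. A real random variable is neat if it is a monotonically increasing (nondecreasing) function $(0,1)\to\mathbb{R}$. $\mathcal{N}^n$ is the set of product random variables $X:(0,1)^n\to\mathbb{R}^n$, $X(s_1,\dots,s_n)=(X_1(s_1),\dots,X_n(s_n))$, with each $X_k$ neat (so the components are mutually independent). $\mathcal{B}_R$: functions $f:\mathbb{R}\to[0,1]$, nonincreasing, left continuous, with limit $1$ at $-\infty$ and $0$ at $\infty$. $\mathcal{B}_L$: functions $f:\mathbb{R}\to[0,1]$, nondecreasing, right continuous, with limit $0$ at $-\infty$ and $1$ at $\infty$. $\mathcal{B}_2=\{(f^-,f^+)\in\mathcal{B}_L\times\mathcal{B}_R : f^-(0)=f^+(0)=1\}$. For $f\in\mathcal{B}_2^n$, $\mathcal{T}_2(f)$ is the set of $X\in\mathcal{N}^n$ such that $P(X_k\ge t)\le f_k^+(t)$ and $P(X_k\le t)\le f_k^-(t)$ for all $t\in\mathbb{R}$ and $k=1,\dots,n$. For $f\in\mathcal{B}_2^n$,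 a closed set $G=G^1\times\cdots\times G^n\ni0$ and $c\in[0,1]^n$, the $2$ shift operator returns $\mathscr{S}_2(f,G,c)=(X_1,\dots,X_n):(0,1)^n\to\mathbb{R}^n$, the product random variable $(s_1,\dots,s_n)\mapsto(X_1(s_1),\dots,X_n(s_n))$ with $$X_k(s)=\begin{cases}\inf\{u\in G^k\cup[\sup G^k,\infty): u\ge\inf (f_k^-)^{-1}[s,1]\}, & 0<s<c_k,\\ \sup\{u\in G^k\cup(-\infty,\inf G^k]: u\le\sup (f_k^+)^{-1}[1-s,1]\}, & c_k\le s<1,\end{cases}$$ where $[\sup G^k,\infty)$ is empty if $\sup G^k=\infty$ and $(-\infty,\inf G^k]$ is empty if $\inf G^k=-\infty$. *)

theory Defs
  imports "HOL-Analysis.Analysis"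
begin

definition open_cube :: "(real^'n) set" where
  "open_cube = {s. \<forall>k. s $ k \<in> {0<..<1}}"

definition cube_measure :: "(real^'n) measure" where
  "cube_measure = restrict_space lborel open_cube"

text \<open>The probability that a vector-valued random variable on the cube has a given property.\<close>

definition cube_prob :: "(real^'n \<Rightarrow> real^'n) \<Rightarrow> (real^'n \<Rightarrow> bool) \<Rightarrow> real" where
  "cube_prob X Q = measure cube_measure {s \<in> space cube_measure. Q (X s)}"

text \<open>Only the values on the open unit interval matter; Borel measurability there
  follows from monotonicity.\<close>

definition neat :: "(real \<Rightarrow> real) \<Rightarrow> bool" where
  "neat Y \<longleftrightarrow> mono_on {0<..<1} Y"

text \<open>The set of neat product random variables. Functions are total, so values outside the
  open cube are left unconstrained.\<close>

definition neat_products :: "(real^'n \<Rightarrow> real^'n) set" where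
  "neat_products =
    {X. \<exists>Y. (\<forall>k. neat (Y k)) \<and> (\<forall>s\<in>open_cube. X s = (\<chi> k. Y k (s $ k)))}"

definition B_R :: "(real \<Rightarrow> real) set" where
  "B_R = {f. range f \<subseteq> {0..1} \<and> antimono f \<and> (\<forall>t. continuous (at_left t) f) \<and>
             (f \<longlongrightarrow> 1) at_bot \<and> (f \<longlongrightarrow> 0) at_top}"

definition B_L :: "(real \<Rightarrow> real) set" where
  "B_L = {f. range f \<subseteq> {0..1} \<and> mono f \<and> (\<forall>t. continuous (at_right t) f) \<and>
             (f \<longlongrightarrow> 0) at_bot \<and> (f \<longlongrightarrow> 1) at_top}"

text \<open>Bounds are pairs: the first component bounds the left tail, the second the right tail.\<close>

definition B2 :: "((real \<Rightarrow> real) \<times> (real \<Rightarrow> real)) set" where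
  "B2 = {(fm, fp). fm \<in> B_L \<and> fp \<in> B_R \<and> fm 0 = 1 \<and> fp 0 = 1}"

definition T2 :: "('n \<Rightarrow> (real \<Rightarrow> real) \<times> (real \<Rightarrow> real)) \<Rightarrow> (real^'n \<Rightarrow> real^'n) set" where
  "T2 f = {X \<in> neat_products. \<forall>k t.
      cube_prob X (\<lambda>x. x $ k \<ge> t) \<le> snd (f k) t \<and>
      cube_prob X (\<lambda>x. x $ k \<le> t) \<le> fst (f k) t}"

definition set_product :: "('n \<Rightarrow> real set) \<Rightarrow> (real^'n) set" where
  "set_product G = {x. \<forall>k. x $ k \<in> G k}"

text \<open>The rays above the supremum and below the infimum of a nonempty set, empty when the
  extremum is infinite.\<close>

definition upper_ray :: "real set \<Rightarrow> real set" where
  "upper_ray A = (if bdd_above A then {Sup A..} else {})"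

definition lower_ray :: "real set \<Rightarrow> real set" where
  "lower_ray A = (if bdd_below A then {..Inf A} else {})"

text \<open>For admissible bounds, \<open>0 \<in> A\<close> and \<open>0 < s < 1\<close>, every real infimum and supremum below is
  over a nonempty set bounded on the relevant side, as \<open>fm 0 = fp 0 = 1\<close> and the tails of
  \<open>fm\<close> and \<open>fp\<close> vanish.\<close>

definition shift1 :: "(real \<Rightarrow> real) \<times> (real \<Rightarrow> real) \<Rightarrow> real set \<Rightarrow> real \<Rightarrow> real \<Rightarrow> real" where
  "shift1 = (\<lambda>(fm, fp) A c s.
     if s < c then Inf {u \<in> A \<union> upper_ray A. u \<ge> Inf (fm -` {s..1})}
     else Sup {u \<in> A \<union> lower_ray A. u \<le> Sup (fp -` {1 - s..1})})"

text \<open>The product set enters through its factors, which a nonempty product determines.\<close>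

definition shift2 ::
    "('n \<Rightarrow> (real \<Rightarrow> real) \<times> (real \<Rightarrow> real)) \<Rightarrow> ('n \<Rightarrow> real set) \<Rightarrow> real^'n \<Rightarrow> real^'n \<Rightarrow> real^'n"
  where
  "shift2 f G c = (\<lambda>s. \<chi> k. shift1 (f k) (G k) (c $ k) (s $ k))"

end

theory Submission
  imports Defs "HOL-Probability.Infinite_Product_Measure" "HOL-Complex_Analysis.Great_Picard"
begin

text \<open>
  In terms of quantile functions, the tail bounds say exactly that each monotone \<open>X\<^sub>k\<close> lies
  pointwise between a lower quantile function \<open>\<le> 0\<close> and an upper quantile function \<open>\<ge> 0\<close>. A
  diagonal argument on the rationals (Helly selection) and closedness of \<open>V\<close> give a maximizer.

  Fix all coordinates of a maximizer but the \<open>k\<close>-th. By Fubini the probability is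
  \<open>\<integral> h(X\<^sub>k(s)) ds\<close> with \<open>h\<close> upper semicontinuous, and this integrand can be maximized pointwise:
  the maximum of \<open>h\<close> between the lower quantile and \<open>0\<close> decreases in \<open>s\<close>, the maximum between
  \<open>0\<close> and the upper quantile increases, so there is a switching point \<open>c\<close>; and each maximum
  is attained at the extreme record point of \<open>h\<close> (a point whose value is not exceeded on the way
  back to \<open>0\<close>) that the quantile allows. The record points form a closed set \<open>G\<close>, so the
  pointwise maximizer is a shift, in particular monotone. Replacing the coordinates one after
  another by shifts proves the claim.
\<close>

section \<open>The product measure on the cube\<close>

definition unit_measure :: "real measure" where
  "unit_measure = restrict_space lborel {0<..<1}"

lemma space_unit_measure [simp]: "space unit_measure = {0<..<1}"
  by (simp add: unit_measure_def space_restrict_space)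

lemma emeasure_unit_measure: "A \<subseteq> {0<..<1} \<Longrightarrow> emeasure unit_measure A = emeasure lborel A"
  by (simp add: unit_measure_def emeasure_restrict_space)

lemma prob_space_unit_measure: "prob_space unit_measure"
  by (rule prob_spaceI) (simp add: emeasure_unit_measure)

lemma borel_measurable_vecI:
  fixes f :: "'a \<Rightarrow> real^'n"
  assumes "\<And>k. (\<lambda>x. f x $ k) \<in> borel_measurable M"
  shows "f \<in> borel_measurable M"
  by (subst borel_measurable_euclidean_space)
    (auto simp: Basis_vec_def inner_axis intro: assms)

lemma open_cube_borel [measurable]: "(open_cube :: (real^'n) set) \<in> sets borel"
proof -
  have "(open_cube :: (real^'n) set) = (\<Inter>k. (\<lambda>s. s $ k) -` {0<..<1} \<inter> space borel)"
    by (auto simp: open_cube_def)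
  also have "\<dots> \<in> sets borel"
    by (intro sets.finite_INT measurable_sets[OF borel_measurable_nth]) auto
  finally show ?thesis .
qed

text \<open>\<open>lborel\<close> on vectors is indexed by \<open>Basis\<close>, while the product
  measures below run over the index type. Lebesgue measure is determined by its values on boxes, and
  on a box both sides are the product of the side lengths.\<close>

lemma lborel_vec:
  "(lborel :: (real^'n) measure) =
    distr (Pi\<^sub>M (UNIV :: 'n set) (\<lambda>_. lborel)) borel (\<lambda>f. \<chi> k. f k)"
proof (rule lborel_eqI)
  fix l u :: "real^'n"
  interpret product_sigma_finite "\<lambda>_::'n. lborel :: real measure" ..
  assume lu: "\<And>b. b \<in> Basis \<Longrightarrow> l \<bullet> b \<le> u \<bullet> b"
  have le: "l $ k \<le> u $ k" for k
    using lu[of "axis k 1"] by (simp add: inner_axis axis_in_Basis_iff)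
  have [measurable]: "(\<lambda>f. \<chi> k. f k) \<in> Pi\<^sub>M (UNIV :: 'n set) (\<lambda>_. lborel :: real measure) \<rightarrow>\<^sub>M borel"
    by (intro borel_measurable_vecI) simp
  have pre: "(\<lambda>f. \<chi> k. f k) -` box l u \<inter> space (Pi\<^sub>M (UNIV :: 'n set) (\<lambda>_. lborel)) =
      Pi\<^sub>E UNIV (\<lambda>k. {l $ k <..< u $ k})"
    by (auto simp: space_PiM PiE_def box_def Basis_vec_def inner_axis Pi_def)
  have inj: "inj_on (\<lambda>k::'n. axis k (1::real)) UNIV"
    by (auto simp: inj_on_def axis_eq_axis)
  have Basis: "(Basis :: (real^'n) set) = range (\<lambda>k. axis k 1)"
    by (auto simp: Basis_vec_def)
  have "emeasure (distr (Pi\<^sub>M (UNIV :: 'n set) (\<lambda>_. lborel)) borel (\<lambda>f. \<chi> k. f k)) (box l u) =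
      (\<Prod>k\<in>UNIV. emeasure lborel {l $ k <..< u $ k})"
    by (subst emeasure_distr) (auto simp: pre intro!: emeasure_PiM)
  also have "\<dots> = (\<Prod>k\<in>UNIV. ennreal ((u - l) $ k))"
    using le by simp
  also have "\<dots> = ennreal (\<Prod>k\<in>UNIV. (u - l) $ k)"
    using le by (intro prod_ennreal) simp
  also have "(\<Prod>k\<in>UNIV. (u - l) $ k) = (\<Prod>b\<in>Basis. (u - l) \<bullet> b)"
    unfolding Basis by (subst prod.reindex[OF inj]) (simp add: inner_axis)
  finally show "emeasure (distr (Pi\<^sub>M (UNIV :: 'n set) (\<lambda>_. lborel)) borel (\<lambda>f. \<chi> k. f k)) (box l u) =
      (\<Prod>b\<in>Basis. (u - l) \<bullet> b)" .
qed simp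

lemma space_cube_measure [simp]: "space cube_measure = open_cube"
  by (simp add: cube_measure_def space_restrict_space)

lemma measurable_cube_nth:
  "(\<lambda>s::real^'n. s $ k) \<in> cube_measure \<rightarrow>\<^sub>M unit_measure"
  unfolding unit_measure_def cube_measure_def
  by (rule measurable_restrict_space3) (auto simp: open_cube_def)

lemma measurable_cube_lambda [measurable]:
  "(\<lambda>(s::real^'n) k. s $ k) \<in> cube_measure \<rightarrow>\<^sub>M Pi\<^sub>M UNIV (\<lambda>_. unit_measure)"
  by (rule measurable_PiM_single') (auto simp: measurable_cube_nth open_cube_def)

text \<open>Finite product measures are determined by their values on rectangles, and a rectangle
  with sides in the open unit interval lies inside the cube. This makes Fubini and the marginals of
  product measures available for \<open>cube_measure\<close>.\<close>

lemma cube_measure_PiM: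
  "Pi\<^sub>M (UNIV::'n::finite set) (\<lambda>_. unit_measure) =
    distr cube_measure (Pi\<^sub>M UNIV (\<lambda>_. unit_measure)) (\<lambda>s k. s $ k)"
proof (rule sym, rule product_sigma_finite.PiM_eqI)
  fix A :: "'n \<Rightarrow> real set"
  interpret product_sigma_finite "\<lambda>_::'n. lborel :: real measure" ..
  assume A: "\<And>i. i \<in> UNIV \<Longrightarrow> A i \<in> sets unit_measure"
  have A': "A i \<in> sets borel" "A i \<subseteq> {0<..<1}" for i
    using A[of i] by (auto simp: unit_measure_def sets_restrict_space)
  have [measurable]: "(\<lambda>f. \<chi> k. f k) \<in> Pi\<^sub>M (UNIV :: 'n set) (\<lambda>_. lborel :: real measure) \<rightarrow>\<^sub>M borel"
    by (intro borel_measurable_vecI) simp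
  have eq: "{s::real^'n. \<forall>k. s $ k \<in> A k} = (\<Inter>k. (\<lambda>s. s $ k) -` A k \<inter> space borel)"
    by auto
  have B [measurable]: "{s::real^'n. \<forall>k. s $ k \<in> A k} \<in> sets borel"
    unfolding eq by (intro sets.finite_INT measurable_sets[OF borel_measurable_nth] A') auto
  have sub: "{s::real^'n. \<forall>k. s $ k \<in> A k} \<subseteq> open_cube"
    using A'(2) by (force simp: open_cube_def)
  have "emeasure (distr cube_measure (Pi\<^sub>M UNIV (\<lambda>_. unit_measure)) (\<lambda>s k. s $ k)) (Pi\<^sub>E UNIV A)
      = emeasure cube_measure ((\<lambda>s k. s $ k) -` Pi\<^sub>E UNIV A \<inter> space cube_measure)"
    using A by (intro emeasure_distr measurable_cube_lambda sets_PiM_I_finite) auto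
  also have "(\<lambda>(s::real^'n) k. s $ k) -` Pi\<^sub>E UNIV A \<inter> space cube_measure = {s. \<forall>k. s $ k \<in> A k}"
    using sub by (auto simp: PiE_def Pi_def)
  also have "emeasure cube_measure {s::real^'n. \<forall>k. s $ k \<in> A k} = emeasure lborel {s::real^'n. \<forall>k. s $ k \<in> A k}"
    using sub by (simp add: cube_measure_def emeasure_restrict_space)
  also have "\<dots> = emeasure (Pi\<^sub>M (UNIV :: 'n set) (\<lambda>_. lborel)) (Pi\<^sub>E UNIV A)"
    by (subst lborel_vec, subst emeasure_distr)
      (auto simp: space_PiM PiE_def Pi_def intro!: arg_cong[where f="emeasure _"])
  also have "\<dots> = (\<Prod>k\<in>UNIV. emeasure lborel (A k))"
    using A' by (intro emeasure_PiM) auto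
  also have "\<dots> = (\<Prod>k\<in>UNIV. emeasure unit_measure (A k))"
    using A' by (simp add: emeasure_unit_measure)
  finally show "emeasure (distr cube_measure (Pi\<^sub>M UNIV (\<lambda>_. unit_measure)) (\<lambda>s k. s $ k)) (Pi\<^sub>E UNIV A) =
      (\<Prod>k\<in>UNIV. emeasure unit_measure (A k))" .
next
  interpret prob_space unit_measure by (rule prob_space_unit_measure)
  show "product_sigma_finite (\<lambda>_::'n. unit_measure)"
    by unfold_locales 
qed auto

section \<open>Tail bounds as quantile bounds\<close>

text \<open>The threshold in the first branch of \<open>shift1\<close>. As a function of
  \<open>s\<close> it is the lowest quantile function that the left tail bound permits.\<close>

definition lower_quantile :: "(real \<Rightarrow> real) \<Rightarrow> real \<Rightarrow> real" where
  "lower_quantile fm s = Inf (fm -` {s..1})"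

definition upper_quantile :: "(real \<Rightarrow> real) \<Rightarrow> real \<Rightarrow> real" where
  "upper_quantile fp s = Sup (fp -` {1 - s..1})"

text \<open>The infimum is over a nonempty set because \<open>fm 0 = 1\<close>, the set is bounded
  below because \<open>fm\<close> vanishes at minus infinity, and right continuity makes the infimum
  attained. The result is a Galois connection between \<open>fm\<close> and its generalized
  inverse.\<close>

lemma lower_quantile_le_iff:
  assumes fm: "fm \<in> B_L" and fm0: "fm 0 = 1" and s: "0 < s" "s < 1"
  shows "lower_quantile fm s \<le> t \<longleftrightarrow> s \<le> fm t"
proof -
  have mono: "mono fm" and le1: "\<And>u. fm u \<le> 1" and cont: "continuous (at_right t) fm"
    and lim: "(fm \<longlongrightarrow> 0) at_bot"
    using fm by (auto simp: B_L_def image_subset_iff)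
  have "eventually (\<lambda>u. fm u < s) at_bot"
    using order_tendstoD(2)[OF lim s(1)] .
  then obtain b where b: "\<And>u. u \<le> b \<Longrightarrow> fm u < s"
    by (auto simp: eventually_at_bot_linorder)
  have bdd: "bdd_below (fm -` {s..1})"
  proof (rule bdd_belowI[of _ b])
    fix v assume "v \<in> fm -` {s..1}"
    then show "b \<le> v" using b[of v] by (cases "v \<le> b") auto
  qed
  have "0 \<in> fm -` {s..1}"
    using fm0 s by simp
  then have ne: "fm -` {s..1} \<noteq> {}"
    by blast
  show ?thesis
  proof
    assume "s \<le> fm t"
    then show "lower_quantile fm s \<le> t"
      unfolding lower_quantile_def using bdd le1 by (intro cInf_lower) auto
  next
    assume le: "lower_quantile fm s \<le> t"
    have "s \<le> fm u" if "u > t" for u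
    proof -
      have "Inf (fm -` {s..1}) < u" using le that by (simp add: lower_quantile_def)
      then obtain v where "v \<in> fm -` {s..1}" "v < u"
        using cInf_lessD[OF ne] by blast
      then show ?thesis using monoD[OF mono, of v u] by auto
    qed
    then have "eventually (\<lambda>u. s \<le> fm u) (at_right t)"
      by (auto simp: eventually_at_right_less eventually_at_filter)
    moreover have "(fm \<longlongrightarrow> fm t) (at_right t)"
      using cont by (simp add: continuous_within)
    ultimately show "s \<le> fm t"
      by (intro tendsto_lowerbound[of fm "fm t" "at_right t"]) auto
  qed
qed

text \<open>Mirror image of \<open>lower_quantile_le_iff\<close>, with left continuity making the
  supremum attained.\<close>

lemma le_upper_quantile_iff:
  assumes fp: "fp \<in> B_R" and fp0: "fp 0 = 1" and s: "0 < s" "s < 1"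
  shows "t \<le> upper_quantile fp s \<longleftrightarrow> 1 - s \<le> fp t"
proof -
  have mono: "antimono fp" and le1: "\<And>u. fp u \<le> 1" and cont: "continuous (at_left t) fp"
    and lim: "(fp \<longlongrightarrow> 0) at_top"
    using fp by (auto simp: B_R_def image_subset_iff)
  have "eventually (\<lambda>u. fp u < 1 - s) at_top"
    using order_tendstoD(2)[OF lim, of "1 - s"] s by simp
  then obtain b where b: "\<And>u. b \<le> u \<Longrightarrow> fp u < 1 - s"
    by (auto simp: eventually_at_top_linorder)
  have bdd: "bdd_above (fp -` {1 - s..1})"
  proof (rule bdd_aboveI[of _ b])
    fix v assume "v \<in> fp -` {1 - s..1}"
    then show "v \<le> b" using b[of v] by (cases "b \<le> v") auto
  qed
  have "0 \<in> fp -` {1 - s..1}"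
    using fp0 s by simp
  then have ne: "fp -` {1 - s..1} \<noteq> {}"
    by blast
  show ?thesis
  proof
    assume "1 - s \<le> fp t"
    then show "t \<le> upper_quantile fp s"
      unfolding upper_quantile_def using bdd le1 by (intro cSup_upper) auto
  next
    assume le: "t \<le> upper_quantile fp s"
    have "1 - s \<le> fp u" if "u < t" for u
    proof -
      have "u < Sup (fp -` {1 - s..1})" using le that by (simp add: upper_quantile_def)
      then obtain v where "v \<in> fp -` {1 - s..1}" "u < v"
        using less_cSupD[OF ne] by blast
      then show ?thesis using antimonoD[OF mono, of u v] by auto
    qed
    then have "eventually (\<lambda>u. 1 - s \<le> fp u) (at_left t)"
      by (auto simp: eventually_at_filter)
    moreover have "(fp \<longlongrightarrow> fp t) (at_left t)"
      using cont by (simp add: continuous_within)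
    ultimately show "1 - s \<le> fp t"
      by (intro tendsto_lowerbound[of fp "fp t" "at_left t"]) auto
  qed
qed

text \<open>The one-coordinate counterpart of \<open>T2\<close>. Stated through quantiles, the
  constraint bounds each value \<open>Y s\<close> separately, so that values can be optimized
  pointwise.\<close>

definition admissible :: "(real \<Rightarrow> real) \<times> (real \<Rightarrow> real) \<Rightarrow> (real \<Rightarrow> real) \<Rightarrow> bool" where
  "admissible g Y \<longleftrightarrow> neat Y \<and>
    (\<forall>s\<in>{0<..<1}. lower_quantile (fst g) s \<le> Y s \<and> Y s \<le> upper_quantile (snd g) s)"

text \<open>Both bounds equal 1 at 0, so 0 is an allowed value at every \<open>s\<close>; this
  splits the allowed range into a nonpositive and a nonnegative part.\<close>

lemma quantile_signs:
  assumes "g \<in> B2" "s \<in> {0<..<1}"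
  shows "lower_quantile (fst g) s \<le> 0" "0 \<le> upper_quantile (snd g) s"
  using assms by (auto simp: B2_def lower_quantile_le_iff le_upper_quantile_iff)

lemma lower_quantile_mono:
  assumes "g \<in> B2" "0 < s" "s \<le> s'" "s' < 1"
  shows "lower_quantile (fst g) s \<le> lower_quantile (fst g) s'"
proof -
  have "s' \<le> fst g (lower_quantile (fst g) s')"
    using assms lower_quantile_le_iff[of "fst g" s' "lower_quantile (fst g) s'"]
    by (auto simp: B2_def)
  then show ?thesis
    using assms lower_quantile_le_iff[of "fst g" s] by (auto simp: B2_def)
qed

lemma upper_quantile_mono:
  assumes "g \<in> B2" "0 < s" "s \<le> s'" "s' < 1"
  shows "upper_quantile (snd g) s \<le> upper_quantile (snd g) s'"
proof -
  have "1 - s \<le> snd g (upper_quantile (snd g) s)"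
    using assms le_upper_quantile_iff[of "snd g" s "upper_quantile (snd g) s"]
    by (auto simp: B2_def)
  then show ?thesis
    using assms le_upper_quantile_iff[of "snd g" s'] by (auto simp: B2_def)
qed

section \<open>Equivalence of tail bounds and quantile bounds\<close>

lemma sets_unit_measure: "A \<in> sets borel \<Longrightarrow> A \<subseteq> {0<..<1} \<Longrightarrow> A \<in> sets unit_measure"
  by (auto simp: unit_measure_def sets_restrict_space_iff)

lemma neat_measurable: "neat Y \<Longrightarrow> Y \<in> borel_measurable unit_measure"
  unfolding neat_def unit_measure_def
  by (drule borel_measurable_mono_on_fnc) (simp add: measurable_def space_restrict_space sets_restrict_space)

lemma measure_unit_measure_interval:
  assumes "0 \<le> a" "b \<le> 1" "a \<le> b"
  shows "measure unit_measure ({a<..b} \<inter> {0<..<1}) = b - a"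
    "measure unit_measure ({a..<b} \<inter> {0<..<1}) = b - a"
proof -
  \<comment> \<open>Intersecting with the open unit interval drops an endpoint exactly if that
    endpoint is 1 or 0.\<close>
  have 1: "{a<..b} \<inter> {0<..<1} = (if b = 1 then {a<..<b} else {a<..b})" 
    and 2: "{a..<b} \<inter> {0<..<1} = (if a = 0 then {a<..<b} else {a..<b})"
    using assms by auto
  show "measure unit_measure ({a<..b} \<inter> {0<..<1}) = b - a"
    unfolding measure_def by (subst emeasure_unit_measure, simp) (unfold 1, use assms in auto)
  show "measure unit_measure ({a..<b} \<inter> {0<..<1}) = b - a"
    unfolding measure_def by (subst emeasure_unit_measure, simp) (unfold 2, use assms in auto)
qed

text \<open>Forwards, \<open>Y s \<ge> t\<close> puts \<open>t\<close> below the upper quantile,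
  that is \<open>s \<ge> 1 - snd g t\<close>, and such \<open>s\<close> fill an interval of length
  \<open>snd g t\<close>. Backwards, the tail bound is taken at the level \<open>Y s\<close> itself:
  by monotonicity the event contains every point on the relevant side of \<open>s\<close>.\<close>

lemma admissible_iff_tails:
  assumes g: "g \<in> B2" and Y: "neat Y"
  shows "admissible g Y \<longleftrightarrow>
    (\<forall>t. measure unit_measure {s\<in>{0<..<1}. Y s \<ge> t} \<le> snd g t \<and>
         measure unit_measure {s\<in>{0<..<1}. Y s \<le> t} \<le> fst g t)" (is "_ \<longleftrightarrow> ?R")
proof -
  interpret prob_space unit_measure by (rule prob_space_unit_measure)
  note [measurable] = neat_measurable[OF Y]
  have "{s\<in>space unit_measure. Y s \<le> t} \<in> sets unit_measure"
     "{s\<in>space unit_measure. t \<le> Y s} \<in> sets unit_measure" for t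
    by measurable
  then have sets: "{s\<in>{0<..<1}. Y s \<le> t} \<in> sets unit_measure"
     "{s\<in>{0<..<1}. t \<le> Y s} \<in> sets unit_measure" for t
    by simp_all
  have g': "fst g \<in> B_L" "snd g \<in> B_R" "fst g 0 = 1" "snd g 0 = 1"
    using g by (auto simp: B2_def)
  have rng: "fst g t \<in> {0..1}" "snd g t \<in> {0..1}" for t
    using g'(1,2) by (auto simp: B_L_def B_R_def image_subset_iff)
  have Ym: "Y s \<le> Y s'" if "0 < s" "s \<le> s'" "s' < 1" for s s'
    using Y that by (auto simp: neat_def mono_on_def)
  show ?thesis
  proof
    assume adm: "admissible g Y"
    show ?R
    proof (intro allI conjI)
      fix t
      have "{s\<in>{0<..<1}. Y s \<ge> t} \<subseteq> {1 - snd g t..<1} \<inter> {0<..<1}"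
      proof safe
        fix s :: real assume s: "s \<in> {0<..<1}" "t \<le> Y s"
        then have "t \<le> upper_quantile (snd g) s"
          using adm by (force simp: admissible_def)
        then show "s \<in> {1 - snd g t..<1}"
          using s g' by (auto simp: le_upper_quantile_iff)
      qed
      then have "measure unit_measure {s\<in>{0<..<1}. Y s \<ge> t} \<le> measure unit_measure ({1 - snd g t..<1} \<inter> {0<..<1})"
        by (intro finite_measure_mono sets_unit_measure) auto
      also have "\<dots> = snd g t"
        using rng[of t] by (subst measure_unit_measure_interval) auto
      finally show "measure unit_measure {s\<in>{0<..<1}. Y s \<ge> t} \<le> snd g t" .
      have "{s\<in>{0<..<1}. Y s \<le> t} \<subseteq> {0<..fst g t} \<inter> {0<..<1}"
      proof safe
        fix s :: real assume s: "s \<in> {0<..<1}" "Y s \<le> t"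
        then have "lower_quantile (fst g) s \<le> t"
          using adm by (force simp: admissible_def)
        then show "s \<in> {0<..fst g t}"
          using s g' by (auto simp: lower_quantile_le_iff)
      qed
      then have "measure unit_measure {s\<in>{0<..<1}. Y s \<le> t} \<le> measure unit_measure ({0<..fst g t} \<inter> {0<..<1})"
        by (intro finite_measure_mono sets_unit_measure) auto
      also have "\<dots> = fst g t"
        using rng[of t] by (subst measure_unit_measure_interval) auto
      finally show "measure unit_measure {s\<in>{0<..<1}. Y s \<le> t} \<le> fst g t" .
    qed
  next
    assume R: ?R
    show "admissible g Y"
      unfolding admissible_def
    proof (intro conjI ballI Y)
      fix s :: real assume s: "s \<in> {0<..<1}"
      have "s = measure unit_measure ({0<..s} \<inter> {0<..<1})"
        using s by (subst measure_unit_measure_interval) auto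
      also have "\<dots> \<le> measure unit_measure {s'\<in>{0<..<1}. Y s' \<le> Y s}"
        using s by (intro finite_measure_mono sets) (auto intro: Ym)
      also have "\<dots> \<le> fst g (Y s)" using R by auto
      finally show "lower_quantile (fst g) s \<le> Y s"
        using s g' by (auto simp: lower_quantile_le_iff)
      have "1 - s = measure unit_measure ({s..<1} \<inter> {0<..<1})"
        using s by (subst measure_unit_measure_interval) auto
      also have "\<dots> \<le> measure unit_measure {s'\<in>{0<..<1}. Y s' \<ge> Y s}"
        using s by (intro finite_measure_mono sets) (auto intro: Ym)
      also have "\<dots> \<le> snd g (Y s)" using R by auto
      finally show "Y s \<le> upper_quantile (snd g) s"
        using s g' by (auto simp: le_upper_quantile_iff)
    qed
  qed
qed

section \<open>From single coordinates to random vectors\<close>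

lemma prob_space_cube_measure: "prob_space (cube_measure :: (real^'n) measure)"
proof -
  interpret U: prob_space unit_measure by (rule prob_space_unit_measure)
  interpret product_prob_space "\<lambda>_. unit_measure" "UNIV :: 'n set" by unfold_locales
  have "prob_space (distr (cube_measure :: (real^'n) measure) (Pi\<^sub>M UNIV (\<lambda>_. unit_measure)) (\<lambda>s k. s $ k))"
    unfolding cube_measure_PiM[symmetric] by unfold_locales
  then show ?thesis
    by (rule prob_space_distrD[rotated]) (rule measurable_cube_lambda)
qed

text \<open>A marginal of a product of probability measures is the corresponding factor.\<close>

lemma distr_cube_measure_nth:
  "distr (cube_measure :: (real^'n) measure) unit_measure (\<lambda>s. s $ k) = unit_measure"
proof -
  have "unit_measure = distr (Pi\<^sub>M (UNIV :: 'n set) (\<lambda>_. unit_measure)) unit_measure (\<lambda>x. x k)"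
    by (intro distr_PiM_component[symmetric] prob_space_unit_measure) simp
  also have "\<dots> = distr (cube_measure :: (real^'n) measure) unit_measure (\<lambda>s. s $ k)"
    by (subst cube_measure_PiM, subst distr_distr) (auto simp: comp_def)
  finally show ?thesis ..
qed

text \<open>A representative fixed off the cube as well; changing one component of the random vector
  becomes a function update of \<open>Y\<close>.\<close>

definition product_map :: "('n::finite \<Rightarrow> real \<Rightarrow> real) \<Rightarrow> real^'n \<Rightarrow> real^'n" where
  "product_map Y s = (\<chi> k. Y k (s $ k))"

lemma product_map_measurable:
  fixes Y :: "'n::finite \<Rightarrow> real \<Rightarrow> real"
  assumes "\<And>k. Y k \<in> borel_measurable unit_measure"
  shows "product_map Y \<in> borel_measurable cube_measure"
  unfolding product_map_def
  by (intro borel_measurable_vecI) (simp, rule measurable_compose[OF measurable_cube_nth assms])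

lemma cube_prob_coordinate:
  assumes "{u\<in>{0<..<1}. P (Y k u)} \<in> sets unit_measure"
  shows "cube_prob (product_map Y) (\<lambda>x. P (x $ k)) = measure unit_measure {u\<in>{0<..<1}. P (Y k u)}"
proof -
  have "measure unit_measure {u\<in>{0<..<1}. P (Y k u)} =
      measure (distr (cube_measure :: (real^'a) measure) unit_measure (\<lambda>s. s $ k)) {u\<in>{0<..<1}. P (Y k u)}"
    by (simp add: distr_cube_measure_nth)
  also have "\<dots> = measure cube_measure ((\<lambda>s. s $ k) -` {u\<in>{0<..<1}. P (Y k u)} \<inter> space cube_measure)"
    by (intro measure_distr measurable_cube_nth assms)
  also have "(\<lambda>s. s $ k) -` {u\<in>{0<..<1}. P (Y k u)} \<inter> space cube_measure =
      {s \<in> space cube_measure. P (product_map Y s $ k)}"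
    by (auto simp: open_cube_def product_map_def)
  finally show ?thesis by (simp add: cube_prob_def)
qed

lemma cube_prob_cong:
  assumes "\<And>s. s \<in> open_cube \<Longrightarrow> X s = X' s"
  shows "cube_prob X Q = cube_prob X' Q"
  unfolding cube_prob_def using assms by (intro arg_cong[where f="measure _"]) auto

lemma T2_iff:
  assumes f: "\<forall>k. f k \<in> B2"
  shows "X \<in> T2 f \<longleftrightarrow> (\<exists>Y. (\<forall>k. admissible (f k) (Y k)) \<and> (\<forall>s\<in>open_cube. X s = product_map Y s))"
proof -
  \<comment> \<open>Every representation by neat components can test membership, since the law of
    each coordinate of \<open>X\<close> is that of the corresponding component. What remains is that
    a representation exists.\<close>
  have key: "X \<in> T2 f \<longleftrightarrow> (\<forall>k. admissible (f k) (Y k))"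
    if Y: "\<forall>k. neat (Y k)" and eq: "\<forall>s\<in>open_cube. X s = product_map Y s" for Y
  proof -
    have [measurable]: "Y k \<in> borel_measurable unit_measure" for k
      using Y by (simp add: neat_measurable)
    have "{s\<in>space unit_measure. Y k s \<le> t} \<in> sets unit_measure"
      "{s\<in>space unit_measure. t \<le> Y k s} \<in> sets unit_measure" for t k
      by measurable
    then have "cube_prob X (\<lambda>x. x $ k \<ge> t) = measure unit_measure {u\<in>{0<..<1}. Y k u \<ge> t}"
      "cube_prob X (\<lambda>x. x $ k \<le> t) = measure unit_measure {u\<in>{0<..<1}. Y k u \<le> t}" for k t
      using eq cube_prob_coordinate[of "\<lambda>x. x \<ge> t" Y k] cube_prob_coordinate[of "\<lambda>x. x \<le> t" Y k]
      by (simp_all cong: cube_prob_cong)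
    moreover have "X \<in> neat_products"
      using that by (auto simp: neat_products_def product_map_def)
    ultimately show ?thesis
      using f Y admissible_iff_tails by (auto simp: T2_def)
  qed
  have "\<exists>Y. (\<forall>k. neat (Y k)) \<and> (\<forall>s\<in>open_cube. X s = product_map Y s)" if "X \<in> T2 f"
    using that by (auto simp: T2_def neat_products_def product_map_def)
  then show ?thesis
    using key by (metis admissible_def)
qed

section \<open>Existence of a maximizer and slicing\<close>

text \<open>A reverse Fatou inequality for events: if \<open>X j x\<close> lies in the closed set
  for infinitely many \<open>j\<close>, so does its limit. It serves both the existence of a
  maximizer and semicontinuity in a single coordinate.\<close>

lemma (in finite_measure) measure_limit_in_closed:
  fixes X :: "nat \<Rightarrow> 'a \<Rightarrow> 'b::topological_space"
  assumes [measurable]: "\<And>j. X j \<in> borel_measurable M" "X' \<in> borel_measurable M"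
    and lim: "AE x in M. (\<lambda>j. X j x) \<longlonglongrightarrow> X' x"
    and V: "closed V"
    and a: "a \<longlonglongrightarrow> l" "\<And>j. a j \<le> measure M {x\<in>space M. X j x \<in> V}"
  shows "l \<le> measure M {x\<in>space M. X' x \<in> V}"
proof -
  have [measurable]: "V \<in> sets borel" using V by simp
  \<comment> \<open>The sets \<open>A m\<close> decrease to the event that
    \<open>X j x \<in> V\<close> for infinitely many \<open>j\<close>.\<close>
  define A where "A m = (\<Union>j\<in>{m..}. {x\<in>space M. X j x \<in> V})" for m
  have A [measurable]: "A m \<in> sets M" for m
    unfolding A_def by (intro sets.countable_UN') auto
  have dec: "decseq A"
    unfolding decseq_def A_def by (intro allI impI UN_mono) auto
  have "(\<lambda>m. measure M (A m)) \<longlonglongrightarrow> measure M (\<Inter>m. A m)"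
    using A dec by (intro finite_Lim_measure_decseq) auto
  moreover have "a m \<le> measure M (A m)" for m
    by (rule order_trans[OF a(2)[of m]], rule finite_measure_mono) (auto simp: A_def)
  ultimately have "l \<le> measure M (\<Inter>m. A m)"
    using a(1) by (intro LIMSEQ_le) auto
  also have "\<dots> \<le> measure M {x\<in>space M. X' x \<in> V}"
  proof (rule finite_measure_mono_AE)
    show "AE x in M. x \<in> (\<Inter>m. A m) \<longrightarrow> x \<in> {x \<in> space M. X' x \<in> V}"
      using lim
    proof eventually_elim
      case (elim x)
      show ?case
      proof
        assume x: "x \<in> (\<Inter>m. A m)"
        have "X' x \<in> V"
        proof (rule ccontr)
          assume "X' x \<notin> V"
          then have "eventually (\<lambda>j. X j x \<in> - V) sequentially"
            using V elim by (intro topological_tendstoD) auto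
          then obtain m where "\<And>j. j \<ge> m \<Longrightarrow> X j x \<notin> V"
            by (auto simp: eventually_sequentially)
          moreover have "x \<in> A m" using x by auto
          ultimately show False by (auto simp: A_def)
        qed
        then show "x \<in> {x \<in> space M. X' x \<in> V}"
          using x by (auto simp: A_def)
      qed
    qed
  qed measurable
  finally show ?thesis .
qed

text \<open>Fubini in the \<open>k\<close>-th coordinate. Freezing that coordinate by a constant
  component keeps each slice a probability on the same cube instead of one of lower
  dimension.\<close>

lemma emeasure_cube_slice:
  fixes Y :: "'n::finite \<Rightarrow> real \<Rightarrow> real"
  assumes Y: "\<And>j. Y j \<in> borel_measurable unit_measure" and V: "V \<in> sets borel"
  shows "emeasure cube_measure {s\<in>open_cube. product_map Y s \<in> V} =
    (\<integral>\<^sup>+u. emeasure cube_measure {s\<in>open_cube. product_map (Y(k := \<lambda>_. Y k u)) s \<in> V} \<partial>unit_measure)"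
proof -
  interpret U: prob_space unit_measure by (rule prob_space_unit_measure)
  interpret product_sigma_finite "\<lambda>_::'n. unit_measure" by unfold_locales
  define F where "F Z x = (indicator V (\<chi> j. Z j (x j)) :: ennreal)" for Z :: "'n \<Rightarrow> real \<Rightarrow> real" and x
  have F: "F Z \<in> borel_measurable (Pi\<^sub>M UNIV (\<lambda>_. unit_measure))"
    if "\<And>j. Z j \<in> borel_measurable unit_measure" for Z
  proof -
    have "(\<lambda>x. \<chi> j. Z j (x j)) \<in> borel_measurable (Pi\<^sub>M UNIV (\<lambda>_. unit_measure))"
      by (intro borel_measurable_vecI) (simp, rule measurable_compose[OF measurable_component_singleton], simp, rule that)
    then show ?thesis
      unfolding F_def by (rule measurable_compose) (intro borel_measurable_indicator V)
  qed
  have base: "emeasure cube_measure {s\<in>open_cube. product_map Z s \<in> V} = (\<integral>\<^sup>+x. F Z x \<partial>Pi\<^sub>M UNIV (\<lambda>_. unit_measure))"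
    if Z: "\<And>j. Z j \<in> borel_measurable unit_measure" for Z
  proof -
    have "{s\<in>space cube_measure. product_map Z s \<in> V} \<in> sets cube_measure"
      using product_map_measurable[of Z] Z V by measurable
    then have "emeasure cube_measure {s\<in>open_cube. product_map Z s \<in> V} =
        (\<integral>\<^sup>+s. indicator {s\<in>open_cube. product_map Z s \<in> V} s \<partial>cube_measure)"
      by simp
    also have "\<dots> = (\<integral>\<^sup>+s. F Z (\<lambda>j. s $ j) \<partial>cube_measure)"
      by (intro nn_integral_cong) (auto simp: F_def product_map_def indicator_def)
    also have "\<dots> = (\<integral>\<^sup>+x. F Z x \<partial>Pi\<^sub>M UNIV (\<lambda>_. unit_measure))"
      by (subst cube_measure_PiM) (intro nn_integral_distr[symmetric] measurable_cube_lambda, simp add: F Z)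
    finally show ?thesis .
  qed
  define I where "I = UNIV - {k}"
  have I: "finite I" "k \<notin> I" "insert k I = UNIV"
    by (auto simp: I_def)
  have split: "(\<integral>\<^sup>+x. F Z x \<partial>Pi\<^sub>M UNIV (\<lambda>_. unit_measure)) =
      (\<integral>\<^sup>+u. (\<integral>\<^sup>+x. F Z (x(k := u)) \<partial>Pi\<^sub>M I (\<lambda>_. unit_measure)) \<partial>unit_measure)"
    if Z: "\<And>j. Z j \<in> borel_measurable unit_measure" for Z
    using product_nn_integral_insert_rev[of I k "F Z", unfolded I(3)] F[OF Z] I by simp
  have upd: "F (Y(k := \<lambda>_. Y k u)) (x(k := v)) = F Y (x(k := u))" for u v x
    unfolding F_def by (intro arg_cong[where f="indicator V"]) (simp add: vec_eq_iff)
  have "emeasure cube_measure {s\<in>open_cube. product_map (Y(k := \<lambda>_. Y k u)) s \<in> V} =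
      (\<integral>\<^sup>+x. F Y (x(k := u)) \<partial>Pi\<^sub>M I (\<lambda>_. unit_measure))" for u
  proof -
    have Z: "(Y(k := \<lambda>_. Y k u)) j \<in> borel_measurable unit_measure" for j
      using Y by simp
    show ?thesis
      unfolding base[OF Z] split[OF Z] upd by (simp add: U.emeasure_space_1[simplified])
  qed
  then show ?thesis
    by (simp add: base[OF Y] split[OF Y])
qed

text \<open>Both sides are integrals over slices that differ only in the value at which coordinate
  \<open>k\<close> is frozen, so comparing slices almost everywhere suffices.\<close>

lemma cube_prob_update_le:
  fixes Y :: "'n::finite \<Rightarrow> real \<Rightarrow> real"
  assumes Y: "\<And>j. neat (Y j)" and y: "neat y" and V: "V \<in> sets borel"
    and le: "AE u in unit_measure.
      cube_prob (product_map (Y(k := \<lambda>_. Y k u))) (\<lambda>x. x \<in> V) \<le>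
      cube_prob (product_map (Y(k := \<lambda>_. y u))) (\<lambda>x. x \<in> V)"
  shows "cube_prob (product_map Y) (\<lambda>x. x \<in> V) \<le> cube_prob (product_map (Y(k := y))) (\<lambda>x. x \<in> V)"
proof -
  interpret C: prob_space "cube_measure :: (real^'n) measure" by (rule prob_space_cube_measure)
  have Y': "(Y(k := y)) j \<in> borel_measurable unit_measure" for j
    using Y y by (auto intro: neat_measurable)
  have "emeasure cube_measure {s\<in>open_cube. product_map Y s \<in> V} \<le>
      emeasure cube_measure {s\<in>open_cube. product_map (Y(k := y)) s \<in> V}"
    unfolding emeasure_cube_slice[of Y V k, OF neat_measurable[OF Y] V]
      emeasure_cube_slice[of "Y(k := y)" V k, OF Y' V]
  proof (rule nn_integral_mono_AE)
    show "AE u in unit_measure.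
       emeasure cube_measure {s \<in> open_cube. product_map (Y(k := \<lambda>_. Y k u)) s \<in> V}
       \<le> emeasure cube_measure {s \<in> open_cube. product_map (Y(k := y, k := \<lambda>_. (Y(k := y)) k u)) s \<in> V}"
      using le by eventually_elim (simp add: cube_prob_def C.emeasure_eq_measure)
  qed
  then show ?thesis
    by (simp add: cube_prob_def C.emeasure_eq_measure)
qed

section \<open>Helly selection and existence of a maximizer\<close>

lemma AE_unit_measure_countable:
  assumes "countable D"
  shows "AE s in unit_measure. s \<notin> D"
proof -
  have "AE s in lborel. s \<notin> D"
    by (intro AE_not_in countable_imp_null_set_lborel assms)
  then show ?thesis
    unfolding unit_measure_def by (subst AE_restrict_space_iff) auto
qed

text \<open>The limit step of Helly's theorem: limits at the rationals determine a monotone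
  function, and monotonicity of the \<open>y j\<close> forces convergence at each of its continuity
  points, hence off a countable set.\<close>

lemma admissible_limit:
  assumes g: "g \<in> B2" and y: "\<And>j. admissible g (y j)"
    and conv: "\<And>q. q \<in> \<rat> \<Longrightarrow> 0 < q \<Longrightarrow> q < 1 \<Longrightarrow> convergent (\<lambda>j. y j q)"
  shows "\<exists>z. admissible g z \<and> (AE s in unit_measure. (\<lambda>j. y j s) \<longlonglongrightarrow> z s)"
proof -
  define l where "l q = lim (\<lambda>j. y j q)" for q
  have l: "(\<lambda>j. y j q) \<longlonglongrightarrow> l q" if "q \<in> \<rat>" "0 < q" "q < 1" for q
    unfolding l_def using conv[OF that] by (simp add: convergent_LIMSEQ_iff)
  have ybd: "lower_quantile (fst g) s \<le> y j s" "y j s \<le> upper_quantile (snd g) s" if "0 < s" "s < 1" for j s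
    using y[of j] that by (auto simp: admissible_def)
  have ymono: "y j s \<le> y j s'" if "0 < s" "s \<le> s'" "s' < 1" for j s s'
    using y[of j] that by (auto simp: admissible_def neat_def mono_on_def)
  have lge: "lower_quantile (fst g) s \<le> l q" if "q \<in> \<rat>" "0 < s" "s < q" "q < 1" for s q
  proof -
    have "lower_quantile (fst g) s \<le> y j q" for j
      using ybd(1)[of s j] ymono[of s q j] that by auto
    then show ?thesis using l[of q] that by (intro LIMSEQ_le_const[OF l]) auto
  qed
  define Q where "Q s = {q\<in>\<rat>. s < q \<and> q < (1::real)}" for s
  \<comment> \<open>Taking the infimum over rationals strictly to the right makes \<open>W\<close>
    monotone and defined at every point of the unit interval.\<close>
  define W where "W s = Inf (l ` Q s)" for s
  have Qne: "Q s \<noteq> {}" if "s < 1" for s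
    using Rats_dense_in_real[OF that] by (auto simp: Q_def)
  have bdd: "bdd_below (l ` Q s)" if "0 < s" for s
    using lge that by (intro bdd_belowI[of _ "lower_quantile (fst g) s"]) (auto simp: Q_def)
  have Wmono: "W s \<le> W s'" if "0 < s" "s \<le> s'" "s' < 1" for s s'
    unfolding W_def using that by (intro cInf_superset_mono bdd image_mono) (auto simp: Qne, auto simp: Q_def)
  have Wge: "lower_quantile (fst g) s \<le> W s" if "0 < s" "s < 1" for s
    unfolding W_def using that Qne lge by (intro cInf_greatest) (auto simp: Q_def)
  \<comment> \<open>Taking the minimum saves proving that the upper quantile is right continuous.\<close>
  define z where "z s = min (W s) (upper_quantile (snd g) s)" for s
  have adm: "admissible g z"
    unfolding admissible_def neat_def mono_on_def z_def
  proof (intro conjI allI impI ballI, goal_cases)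
    case (1 s s')
    then show ?case
      using Wmono[of s s'] upper_quantile_mono[OF g, of s s'] by auto
  next
    case (2 s)
    then show ?case
      using Wge[of s] quantile_signs[OF g, of s] by auto
  qed simp
  define D where "D = {s\<in>{0<..<1}. \<not> isCont W s}"
  have "countable D"
    unfolding D_def by (rule mono_on_ctble_discont_open) (auto simp: mono_on_def intro: Wmono)
  then have "AE s in unit_measure. s \<notin> D"
    by (rule AE_unit_measure_countable)
  then have "AE s in unit_measure. (\<lambda>j. y j s) \<longlonglongrightarrow> z s"
  proof (rule AE_mp, intro AE_I2 impI)
    fix s assume "s \<in> space unit_measure" "s \<notin> D"
    then have s: "0 < s" "s < 1" and cont: "isCont W s"
      by (auto simp: D_def)
    have lim: "(\<lambda>j. y j s) \<longlonglongrightarrow> W s"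
    proof (rule order_tendstoI)
      fix a assume a: "a < W s"
      \<comment> \<open>Continuity from the left allows a step down to \<open>s' < s\<close> with
        \<open>a < W s'\<close>. A rational \<open>q\<close> between \<open>s'\<close> and
        \<open>s\<close> then has \<open>a < l q\<close>, and
        \<open>y j q \<le> y j s\<close>.\<close>
      have "eventually (\<lambda>x. a < W x) (at_left s)"
        using order_tendstoD(1)[OF isContD[OF cont] a] by (simp add: eventually_at_split)
      then obtain b where b: "b < s" "\<And>x. b < x \<Longrightarrow> x < s \<Longrightarrow> a < W x"
        using eventually_at_left[of "s - 1" s] by auto
      obtain s' where s': "max b 0 < s'" "s' < s"
        using dense[of "max b 0" s] b(1) s by auto
      obtain q where q: "q \<in> \<rat>" "s' < q" "q < s"
        using Rats_dense_in_real[OF s'(2)] by auto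
      have "a < W s'" using b(2) s' by auto
      also have "W s' \<le> l q"
        unfolding W_def using s s' q by (intro cInf_lower bdd) (auto simp: Q_def)
      finally have "eventually (\<lambda>j. a < y j q) sequentially"
        using l[of q] q s s' by (intro order_tendstoD) auto
      then show "eventually (\<lambda>j. a < y j s) sequentially"
        by (rule eventually_mono) (rule less_le_trans[OF _ ymono], use q s s' in auto)
    next
      fix a assume "W s < a"
      then obtain q where q: "q \<in> Q s" "l q < a"
        unfolding W_def using cInf_lessD[of "l ` Q s" a] Qne[of s] s by auto
      then have "eventually (\<lambda>j. y j q < a) sequentially"
        using l[of q] s by (intro order_tendstoD(2)) (auto simp: Q_def)
      then show "eventually (\<lambda>j. y j s < a) sequentially"
        by (rule eventually_mono) (rule le_less_trans[OF ymono], use q s in \<open>auto simp: Q_def\<close>)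
    qed
    \<comment> \<open>The limit inherits the upper bound of the \<open>y j\<close>, so the
      truncation in \<open>z\<close> leaves the value at a continuity point unchanged.\<close>
    have "W s \<le> upper_quantile (snd g) s"
      using ybd(2)[OF s] by (intro LIMSEQ_le_const2[OF lim]) auto
    then show "(\<lambda>j. y j s) \<longlonglongrightarrow> z s" using lim by (simp add: z_def)
  qed
  with adm show ?thesis by blast
qed

lemma AE_cube_nth:
  fixes P :: "'n::finite \<Rightarrow> real \<Rightarrow> bool"
  assumes "\<And>k. AE u in unit_measure. P k u"
  shows "AE s in cube_measure. \<forall>k. P k (s $ k)"
proof -
  have "AE u in distr (cube_measure :: (real^'n) measure) unit_measure (\<lambda>s. s $ k). P k u" for k
    unfolding distr_cube_measure_nth by (rule assms)
  then have "AE s in (cube_measure :: (real^'n) measure). P k (s $ k)" for k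
    by (rule AE_distrD[OF measurable_cube_nth])
  then show ?thesis by (simp add: AE_all_countable)
qed

text \<open>One subsequence converges at all rationals and in all coordinates; the coordinatewise
  Helly limits then converge almost everywhere on the cube, and closedness of \<open>V\<close>
  carries the lower bound to the limit.\<close>

lemma admissible_maximizer_exists:
  fixes f :: "'n::finite \<Rightarrow> (real \<Rightarrow> real) \<times> (real \<Rightarrow> real)"
  assumes f: "\<And>k. f k \<in> B2" and V: "closed V"
    and Y: "\<And>j k. admissible (f k) (Y j k)"
    and a: "a \<longlonglongrightarrow> l" "\<And>j. a j \<le> cube_prob (product_map (Y j)) (\<lambda>x. x \<in> V)"
  shows "\<exists>Z. (\<forall>k. admissible (f k) (Z k)) \<and> l \<le> cube_prob (product_map Z) (\<lambda>x. x \<in> V)"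
proof -
  \<comment> \<open>The quantile bounds depend on the point and may blow up near 0 and 1, whereas
    the diagonal argument asks for one bound for all points. Dividing by \<open>b\<close> normalizes
    the values; the summand 1 keeps the divisor positive.\<close>
  define b where "b k s = 1 + \<bar>lower_quantile (fst (f k)) s\<bar> + \<bar>upper_quantile (snd (f k)) s\<bar>" for k s
  have bpos: "b k s > 0" for k s by (simp add: b_def add_pos_nonneg)
  define S where "S = \<rat> \<inter> {0<..<1::real}"
  have bound: "norm ((\<chi> k. Y j k q / b k q) :: real^'n) \<le> real CARD('n)" if "q \<in> S" for j q
  proof -
    have "\<bar>Y j k q / b k q\<bar> \<le> 1" for k
    proof -
      have "lower_quantile (fst (f k)) q \<le> Y j k q" "Y j k q \<le> upper_quantile (snd (f k)) q"
        using Y[of k j] that by (auto simp: admissible_def S_def)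
      then have "\<bar>Y j k q\<bar> \<le> b k q" by (auto simp: b_def)
      then show ?thesis using bpos[of k q] by (simp add: abs_divide)
    qed
    then have "(\<Sum>k\<in>UNIV. \<bar>((\<chi> k. Y j k q / b k q) :: real^'n) $ k\<bar>) \<le> (\<Sum>k\<in>(UNIV::'n set). 1)"
      by (intro sum_mono) simp
    then show ?thesis
      using norm_le_l1_cart[of "(\<chi> k. Y j k q / b k q) :: real^'n"] by simp
  qed
  have "countable S"
    unfolding S_def by (intro countable_Int1 countable_rat)
  then obtain r where r: "strict_mono (r::nat\<Rightarrow>nat)"
    and conv: "\<And>q. q \<in> S \<Longrightarrow> \<exists>L. (\<lambda>j. (\<chi> k. Y (r j) k q / b k q) :: real^'n) \<longlonglongrightarrow> L"
    by (rule function_convergent_subsequence[of S "\<lambda>j q. (\<chi> k. Y j k q / b k q) :: real^'n", OF _ bound])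
      (assumption, rule that)
  have "convergent (\<lambda>j. Y (r j) k q)" if q: "q \<in> \<rat>" "0 < q" "q < 1" for k q
  proof -
    obtain L where "(\<lambda>j. (\<chi> k. Y (r j) k q / b k q) :: real^'n) \<longlonglongrightarrow> L"
      using conv[of q] q by (auto simp: S_def)
    then have "(\<lambda>j. Y (r j) k q / b k q) \<longlonglongrightarrow> L $ k"
      by (drule_tac tendsto_vec_nth[where i=k]) simp
    \<comment> \<open>The normalization is undone, as \<open>b\<close> does not depend on
      \<open>j\<close>.\<close>
    then have "(\<lambda>j. Y (r j) k q / b k q * b k q) \<longlonglongrightarrow> L $ k * b k q"
      by (intro tendsto_intros)
    then show ?thesis
      using bpos[of k q] by (auto simp: convergent_def)
  qed
  then have "\<forall>k. \<exists>z. admissible (f k) z \<and> (AE s in unit_measure. (\<lambda>j. Y (r j) k s) \<longlonglongrightarrow> z s)"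
    using f Y by (intro allI admissible_limit) auto
  then obtain Z where Z: "\<And>k. admissible (f k) (Z k)"
    and lim: "\<And>k. AE s in unit_measure. (\<lambda>j. Y (r j) k s) \<longlonglongrightarrow> Z k s"
    by metis
  have neat: "neat (Z k)" "neat (Y j k)" for j k
    using Z Y by (auto simp: admissible_def)
  interpret C: prob_space "cube_measure :: (real^'n) measure" by (rule prob_space_cube_measure)
  have "AE s in cube_measure. (\<lambda>j. product_map (Y (r j)) s) \<longlonglongrightarrow> product_map Z s"
    using AE_cube_nth[of "\<lambda>k u. (\<lambda>j. Y (r j) k u) \<longlonglongrightarrow> Z k u", OF lim]
    by eventually_elim (auto simp: product_map_def intro: tendsto_vec_lambda)
  moreover have "(\<lambda>j. a (r j)) \<longlonglongrightarrow> l"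
    using LIMSEQ_subseq_LIMSEQ[OF a(1) r] by (simp add: comp_def)
  ultimately have "l \<le> cube_prob (product_map Z) (\<lambda>x. x \<in> V)"
    unfolding cube_prob_def using a(2) V neat
    by (intro C.measure_limit_in_closed[of "\<lambda>j. product_map (Y (r j))" "product_map Z" V "\<lambda>j. a (r j)"])
      (auto intro!: product_map_measurable neat_measurable simp: cube_prob_def)
  with Z show ?thesis by blast
qed

section \<open>Optimality of shifts\<close>

text \<open>The added ray starts at \<open>Sup G \<ge> 0\<close>, while 0 is already a candidate in
  \<open>G\<close> because the lower quantile is nonpositive. Hence the infimum is the least element
  of \<open>G\<close> above the quantile, attained as \<open>G\<close> is closed.\<close>

lemma shift1_left:
  assumes g: "g \<in> B2" and G: "closed G" "0 \<in> G" and s: "0 < s" "s < 1" "s < c"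
  shows "shift1 g G c s \<in> G" "lower_quantile (fst g) s \<le> shift1 g G c s" "shift1 g G c s \<le> 0"
    "\<And>u. u \<in> G \<Longrightarrow> lower_quantile (fst g) s \<le> u \<Longrightarrow> shift1 g G c s \<le> u"
proof -
  define q where "q = lower_quantile (fst g) s"
  have q: "q \<le> 0" using quantile_signs(1)[OF g] s by (simp add: q_def)
  define m where "m = Inf (G \<inter> {q..})"
  have bdd: "bdd_below (G \<inter> {q..})" by (intro bdd_belowI[of _ q]) auto
  have mG: "m \<in> G \<inter> {q..}"
    unfolding m_def using G q by (intro closed_contains_Inf bdd closed_Int) auto
  have min: "m \<le> u" if "u \<in> G" "q \<le> u" for u
    unfolding m_def using that by (intro cInf_lower bdd) auto
  have ray: "m \<le> u" if "u \<in> upper_ray G" for u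
  proof -
    have "bdd_above G" "Sup G \<le> u"
      using that by (auto simp: upper_ray_def split: if_splits)
    then have "0 \<le> u" using cSup_upper[OF G(2)] by auto
    then show ?thesis using min[OF G(2)] q by simp
  qed
  have "shift1 g G c s = Inf {u \<in> G \<union> upper_ray G. q \<le> u}"
    using s by (simp add: shift1_def q_def lower_quantile_def split: prod.splits)
  also have "\<dots> = m"
    using mG min ray by (intro cInf_eq_minimum) auto
  finally have eq: "shift1 g G c s = m" .
  show "shift1 g G c s \<in> G" "lower_quantile (fst g) s \<le> shift1 g G c s" "shift1 g G c s \<le> 0"
    using eq mG min[OF G(2)] q by (auto simp: q_def)
  show "\<And>u. u \<in> G \<Longrightarrow> lower_quantile (fst g) s \<le> u \<Longrightarrow> shift1 g G c s \<le> u"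
    using eq min by (auto simp: q_def)
qed

text \<open>Mirror image of \<open>shift1_left\<close>: the shift is the greatest element of
  \<open>G\<close> below the upper quantile.\<close>

lemma shift1_right:
  assumes g: "g \<in> B2" and G: "closed G" "0 \<in> G" and s: "0 < s" "s < 1" "c \<le> s"
  shows "shift1 g G c s \<in> G" "shift1 g G c s \<le> upper_quantile (snd g) s" "0 \<le> shift1 g G c s"
    "\<And>u. u \<in> G \<Longrightarrow> u \<le> upper_quantile (snd g) s \<Longrightarrow> u \<le> shift1 g G c s"
proof -
  define q where "q = upper_quantile (snd g) s"
  have q: "0 \<le> q" using quantile_signs(2)[OF g] s by (simp add: q_def)
  define m where "m = Sup (G \<inter> {..q})"
  have bdd: "bdd_above (G \<inter> {..q})" by (intro bdd_aboveI[of _ q]) auto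
  have mG: "m \<in> G \<inter> {..q}"
    unfolding m_def using G q by (intro closed_contains_Sup bdd closed_Int) auto
  have max: "u \<le> m" if "u \<in> G" "u \<le> q" for u
    unfolding m_def using that by (intro cSup_upper bdd) auto
  have ray: "u \<le> m" if "u \<in> lower_ray G" for u
  proof -
    have "bdd_below G" "u \<le> Inf G"
      using that by (auto simp: lower_ray_def split: if_splits)
    then have "u \<le> 0" using cInf_lower[OF G(2)] by auto
    then show ?thesis using max[OF G(2)] q by simp
  qed
  have "shift1 g G c s = Sup {u \<in> G \<union> lower_ray G. u \<le> q}"
    using s by (simp add: shift1_def q_def upper_quantile_def split: prod.splits)
  also have "\<dots> = m"
    using mG max ray by (intro cSup_eq_maximum) auto
  finally have eq: "shift1 g G c s = m" .
  show "shift1 g G c s \<in> G" "shift1 g G c s \<le> upper_quantile (snd g) s" "0 \<le> shift1 g G c s"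
    using eq mG max[OF G(2)] q by (auto simp: q_def)
  show "\<And>u. u \<in> G \<Longrightarrow> u \<le> upper_quantile (snd g) s \<Longrightarrow> u \<le> shift1 g G c s"
    using eq max by (auto simp: q_def)
qed

text \<open>Each branch is monotone because the quantiles are, and the jump at \<open>c\<close> goes
  upwards because the left branch is nonpositive and the right branch nonnegative.\<close>

lemma admissible_shift1:
  assumes g: "g \<in> B2" and G: "closed G" "0 \<in> G"
  shows "admissible g (shift1 g G c)"
  unfolding admissible_def neat_def
proof (intro conjI ballI mono_onI)
  fix s s' :: real assume "s \<in> {0<..<1}" "s' \<in> {0<..<1}" "s \<le> s'"
  then have s: "0 < s" "s \<le> s'" "s' < 1" by auto
  consider "s' < c" | "s < c" "c \<le> s'" | "c \<le> s" by linarith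
  then show "shift1 g G c s \<le> shift1 g G c s'"
  proof cases
    case 1
    then show ?thesis
      using s shift1_left(1,2)[OF g G, of s' c] lower_quantile_mono[OF g s]
      by (intro shift1_left(4)[OF g G]) auto
  next
    case 2
    then show ?thesis
      using s shift1_left(3)[OF g G, of s c] shift1_right(3)[OF g G, of s' c] by auto
  next
    case 3
    then show ?thesis
      using s shift1_right(1,2)[OF g G, of s c] upper_quantile_mono[OF g s]
      by (intro shift1_right(4)[OF g G]) auto
  qed
next
  fix s :: real assume s: "s \<in> {0<..<1}"
  then show "lower_quantile (fst g) s \<le> shift1 g G c s"
    using shift1_left(2)[OF g G, of s c] shift1_right(3)[OF g G, of s c] quantile_signs(1)[OF g s]
    by (cases "s < c") auto
  show "shift1 g G c s \<le> upper_quantile (snd g) s"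
    using s shift1_left(3)[OF g G, of s c] shift1_right(2)[OF g G, of s c] quantile_signs(2)[OF g s]
    by (cases "s < c") auto
qed

section \<open>Record points of upper semicontinuous functions\<close>

lemma upper_semicontinuous_attains_max:
  fixes h :: "'a::t2_space \<Rightarrow> real"
  assumes h: "\<And>a. closed {u. a \<le> h u}" and K: "compact K" "K \<noteq> {}"
  shows "\<exists>u\<in>K. \<forall>v\<in>K. h v \<le> h u"
proof -
  \<comment> \<open>Finite intersection property: for finitely many \<open>v\<close>, the one with
    the largest \<open>h v\<close> lies in all the superlevel sets.\<close>
  have "K \<inter> (\<Inter>v\<in>K. {u. h v \<le> h u}) \<noteq> {}"
  proof (rule compact_imp_fip_image[OF K(1) h])
    fix I assume I: "finite I" "I \<subseteq> K"
    show "K \<inter> (\<Inter>v\<in>I. {u. h v \<le> h u}) \<noteq> {}"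
    proof (cases "I = {}")
      case False
      then have "Max (h ` I) \<in> h ` I" using I by simp
      then obtain u where u: "u \<in> I" "h u = Max (h ` I)" by auto
      then have "h v \<le> h u" if "v \<in> I" for v using I that by simp
      then show ?thesis using u I by blast
    qed (use K in simp)
  qed
  then show ?thesis by blast
qed

text \<open>Along this set \<open>h\<close> can only grow with the distance from 0, so the farthest
  allowed record is the best one. Ties count as records, and such weak inequalities pass to
  limits.\<close>

definition left_records :: "(real \<Rightarrow> real) \<Rightarrow> real set" where
  "left_records h = {u. u \<le> 0 \<and> (\<forall>v\<in>{u..0}. h v \<le> h u)}"

definition right_records :: "(real \<Rightarrow> real) \<Rightarrow> real set" where
  "right_records h = {u. 0 \<le> u \<and> (\<forall>v\<in>{0..u}. h v \<le> h u)}"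

text \<open>A point \<open>v\<close> with \<open>l < v \<le> 0\<close> eventually lies between
  \<open>x n\<close> and 0, so \<open>x n\<close> stays in the closed set where \<open>h\<close> is
  at least \<open>h v\<close>, and so does \<open>l\<close>.\<close>

lemma closed_left_records:
  fixes h :: "real \<Rightarrow> real"
  assumes h: "\<And>a. closed {u. a \<le> h u}"
  shows "closed (left_records h)"
  unfolding closed_sequential_limits
proof (intro allI impI, elim conjE)
  fix x l assume x: "\<forall>n. x n \<in> left_records h" and lim: "x \<longlonglongrightarrow> l"
  have "h v \<le> h l" if v: "l < v" "v \<le> 0" for v
  proof -
    have "eventually (\<lambda>n. x n \<in> {u. h v \<le> h u}) sequentially"
      using order_tendstoD(2)[OF lim v(1)]
      by (rule eventually_mono) (use x v in \<open>auto simp: left_records_def\<close>)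
    then show ?thesis
      using Lim_in_closed_set[OF h _ _ lim] by auto
  qed
  then have "h v \<le> h l" if "l \<le> v" "v \<le> 0" for v
    using that by (cases "v = l") auto
  moreover have "l \<le> 0"
    using x by (intro LIMSEQ_le_const2[OF lim]) (auto simp: left_records_def)
  ultimately show "l \<in> left_records h" by (auto simp: left_records_def)
qed

lemma closed_right_records:
  fixes h :: "real \<Rightarrow> real"
  assumes h: "\<And>a. closed {u. a \<le> h u}"
  shows "closed (right_records h)"
  unfolding closed_sequential_limits
proof (intro allI impI, elim conjE)
  fix x l assume x: "\<forall>n. x n \<in> right_records h" and lim: "x \<longlonglongrightarrow> l"
  have "h v \<le> h l" if v: "0 \<le> v" "v < l" for v
  proof -
    have "eventually (\<lambda>n. x n \<in> {u. h v \<le> h u}) sequentially"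
      using order_tendstoD(1)[OF lim v(2)]
      by (rule eventually_mono) (use x v in \<open>auto simp: right_records_def\<close>)
    then show ?thesis
      using Lim_in_closed_set[OF h _ _ lim] by auto
  qed
  then have "h v \<le> h l" if "0 \<le> v" "v \<le> l" for v
    using that by (cases "v = l") auto
  moreover have "0 \<le> l"
    using x by (intro LIMSEQ_le_const[OF lim]) (auto simp: right_records_def)
  ultimately show "l \<in> right_records h" by (auto simp: right_records_def)
qed

text \<open>One set \<open>G\<close> serves all \<open>s\<close> because records depend on
  \<open>h\<close> alone; the quantiles only decide how far out one may go. At \<open>s = c\<close>
  the shift takes the right branch, which may be the worse one there, hence the exclusion.\<close>

lemma pointwise_optimal_shift:
  fixes h :: "real \<Rightarrow> real"
  assumes g: "g \<in> B2" and h: "\<And>a. closed {u. a \<le> h u}"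
  shows "\<exists>G c. closed G \<and> 0 \<in> G \<and> c \<in> {0..1} \<and>
    (\<forall>s\<in>{0<..<1} - {c}. \<forall>y. lower_quantile (fst g) s \<le> y \<longrightarrow> y \<le> upper_quantile (snd g) s \<longrightarrow>
       h y \<le> h (shift1 g G c s))"
proof -
  define G where "G = left_records h \<union> right_records h"
  have G: "closed G" "0 \<in> G"
    unfolding G_def using closed_left_records[OF h] closed_right_records[OF h]
    by (auto simp: left_records_def)
  \<comment> \<open>With switching point 1 or 0 the shift is in a single branch on the whole open
    unit interval.\<close>
  define l where "l = shift1 g G 1"
  define r where "r = shift1 g G 0"
  have l_max: "h y \<le> h (l s)" if s: "0 < s" "s < 1" and y: "lower_quantile (fst g) s \<le> y" "y \<le> 0" for s y
  proof -
    define q where "q = lower_quantile (fst g) s"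
    have "q \<le> 0" using y by (simp add: q_def)
    then obtain u where u: "u \<in> {q..0}" "\<forall>v\<in>{q..0}. h v \<le> h u"
      using upper_semicontinuous_attains_max[OF h, of "{q..0}"] by auto
    then have "u \<in> left_records h" by (auto simp: left_records_def)
    then have "l s \<le> u"
      unfolding l_def using s u by (intro shift1_left(4)[OF g G]) (auto simp: G_def q_def)
    \<comment> \<open>A nonpositive element of \<open>G\<close> that comes from
      \<open>right_records h\<close> can only be 0, which is a left record too.\<close>
    moreover have "l s \<in> left_records h"
    proof -
      have "l s \<in> G" "l s \<le> 0"
        using shift1_left(1,3)[OF g G, of s 1] s by (auto simp: l_def)
      then show ?thesis by (auto simp: G_def left_records_def right_records_def)
    qed
    ultimately have "h u \<le> h (l s)" using u by (auto simp: left_records_def)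
    then show ?thesis using u y by (force simp: q_def)
  qed
  have r_max: "h y \<le> h (r s)" if s: "0 < s" "s < 1" and y: "y \<le> upper_quantile (snd g) s" "0 \<le> y" for s y
  proof -
    define q where "q = upper_quantile (snd g) s"
    have "0 \<le> q" using y by (simp add: q_def)
    then obtain u where u: "u \<in> {0..q}" "\<forall>v\<in>{0..q}. h v \<le> h u"
      using upper_semicontinuous_attains_max[OF h, of "{0..q}"] by auto
    then have "u \<in> right_records h" by (auto simp: right_records_def)
    then have "u \<le> r s"
      unfolding r_def using s u by (intro shift1_right(4)[OF g G]) (auto simp: G_def q_def)
    moreover have "r s \<in> right_records h"
    proof -
      have "r s \<in> G" "0 \<le> r s"
        using shift1_right(1,3)[OF g G, of s 0] s by (auto simp: r_def)
      then show ?thesis by (auto simp: G_def left_records_def right_records_def)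
    qed
    ultimately have "h u \<le> h (r s)" using u by (auto simp: right_records_def)
    then show ?thesis using u y by (force simp: q_def)
  qed
  \<comment> \<open>The value \<open>l s'\<close> is also allowed at the smaller \<open>s\<close>,
    where the lower quantile is smaller.\<close>
  have l_anti: "h (l s') \<le> h (l s)" if "0 < s" "s \<le> s'" "s' < 1" for s s'
    using shift1_left(2,3)[OF g G, of s' 1] lower_quantile_mono[OF g that] that
    by (intro l_max) (auto simp: l_def)
  have r_mono: "h (r s) \<le> h (r s')" if "0 < s" "s \<le> s'" "s' < 1" for s s'
    using shift1_right(2,3)[OF g G, of s 0] upper_quantile_mono[OF g that] that
    by (intro r_max) (auto simp: r_def)
  \<comment> \<open>Here \<open>S\<close> collects the points where the left branch is at least as
    good; inserting 0 keeps it nonempty, so that its supremum is meaningful.\<close>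
  define S where "S = insert 0 {s\<in>{0<..<1}. h (r s) \<le> h (l s)}"
  define c where "c = Sup S"
  have bdd: "bdd_above S" by (intro bdd_aboveI[of _ 1]) (auto simp: S_def)
  have c: "c \<in> {0..1}"
    unfolding c_def using bdd by (auto intro!: cSup_upper cSup_least simp: S_def)
  have "h y \<le> h (shift1 g G c s)"
    if s: "0 < s" "s < 1" "s \<noteq> c" and y: "lower_quantile (fst g) s \<le> y" "y \<le> upper_quantile (snd g) s" for s y
  proof (cases "s < c")
    case True
    then obtain s' where s': "s' \<in> S" "s < s'"
      unfolding c_def using less_cSupD[of S s] by (auto simp: S_def)
    \<comment> \<open>The chain is
      \<open>h (r s) \<le> h (r s') \<le> h (l s') \<le> h (l s)\<close>.\<close>
    then have "h (r s) \<le> h (l s)"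
      using r_mono[of s s'] l_anti[of s s'] s by (auto simp: S_def)
    moreover have "shift1 g G c s = l s"
      using True s by (simp add: l_def shift1_def split: prod.splits)
    ultimately show ?thesis
      using l_max[of s y] r_max[of s y] s y by (cases "y \<le> 0") auto
  next
    case False
    then have "s \<notin> S" using s cSup_upper[OF _ bdd, of s] by (auto simp: c_def)
    then have "h (l s) \<le> h (r s)" using s by (auto simp: S_def)
    moreover have "shift1 g G c s = r s"
      using False s by (simp add: r_def shift1_def split: prod.splits)
    ultimately show ?thesis
      using l_max[of s y] r_max[of s y] s y by (cases "y \<le> 0") auto
  qed
  then show ?thesis
    using G c by (intro exI[of _ G] exI[of _ c]) auto
qed

section \<open>Replacing the coordinates of a random vector by shifts\<close>

lemma closed_superlevel_coordinate:
  fixes Y :: "'n::finite \<Rightarrow> real \<Rightarrow> real"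
  assumes Y: "\<And>j. neat (Y j)" and V: "closed V"
  shows "closed {u. a \<le> cube_prob (product_map (Y(k := \<lambda>_. u))) (\<lambda>x. x \<in> V)}"
  unfolding closed_sequential_limits
proof (intro allI impI, elim conjE)
  interpret C: prob_space "cube_measure :: (real^'n) measure" by (rule prob_space_cube_measure)
  fix x l assume x: "\<forall>n. x n \<in> {u. a \<le> cube_prob (product_map (Y(k := \<lambda>_. u))) (\<lambda>x. x \<in> V)}"
    and lim: "x \<longlonglongrightarrow> l"
  have meas: "product_map (Y(k := \<lambda>_. u)) \<in> borel_measurable cube_measure" for u
    by (rule product_map_measurable) (auto intro: neat_measurable Y)
  have "(\<lambda>n. product_map (Y(k := \<lambda>_. x n)) s) \<longlonglongrightarrow> product_map (Y(k := \<lambda>_. l)) s" for s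
    unfolding product_map_def
  proof (rule tendsto_vec_lambda)
    show "(\<lambda>n. (Y(k := \<lambda>_. x n)) j (s $ j)) \<longlonglongrightarrow> (Y(k := \<lambda>_. l)) j (s $ j)" for j
      using lim by (cases "j = k") auto
  qed
  then have "AE s in cube_measure. (\<lambda>n. product_map (Y(k := \<lambda>_. x n)) s) \<longlonglongrightarrow> product_map (Y(k := \<lambda>_. l)) s"
    by (rule AE_I2)
  moreover have "a \<le> measure cube_measure {s \<in> space cube_measure. product_map (Y(k := \<lambda>_. x n)) s \<in> V}" for n
    using x unfolding cube_prob_def by blast
  ultimately have "a \<le> cube_prob (product_map (Y(k := \<lambda>_. l))) (\<lambda>x. x \<in> V)"
    unfolding cube_prob_def
    by (rule C.measure_limit_in_closed[OF meas meas _ V tendsto_const])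
  then show "l \<in> {u. a \<le> cube_prob (product_map (Y(k := \<lambda>_. u))) (\<lambda>x. x \<in> V)}" by simp
qed

text \<open>The slice probability \<open>h\<close> does not involve the component
  \<open>Y k\<close>. Hence it is a fixed upper semicontinuous function, the shift maximizes it at
  almost every \<open>s\<close>, and integration over the slices concludes.\<close>

lemma replace_by_shift:
  fixes f :: "'n::finite \<Rightarrow> (real \<Rightarrow> real) \<times> (real \<Rightarrow> real)"
  assumes f: "\<And>k. f k \<in> B2" and V: "closed V" and Y: "\<And>k. admissible (f k) (Y k)"
  shows "\<exists>G c. closed G \<and> 0 \<in> G \<and> c \<in> {0..1} \<and>
    cube_prob (product_map Y) (\<lambda>x. x \<in> V) \<le>
    cube_prob (product_map (Y(k := shift1 (f k) G c))) (\<lambda>x. x \<in> V)"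
proof -
  define h where "h u = cube_prob (product_map (Y(k := \<lambda>_. u))) (\<lambda>x. x \<in> V)" for u
  have neat: "neat (Y j)" for j using Y[of j] by (simp add: admissible_def)
  have usc: "closed {u. a \<le> h u}" for a
    unfolding h_def by (rule closed_superlevel_coordinate[OF neat V])
  obtain G c where G: "closed G" "0 \<in> G" "c \<in> {0..1}"
    and opt: "\<forall>s\<in>{0<..<1} - {c}. \<forall>y. lower_quantile (fst (f k)) s \<le> y \<longrightarrow>
      y \<le> upper_quantile (snd (f k)) s \<longrightarrow> h y \<le> h (shift1 (f k) G c s)"
    using pointwise_optimal_shift[OF f[of k] usc] by blast
  have "AE s in unit_measure. s \<notin> {c}"
    by (rule AE_unit_measure_countable) simp
  then have "AE s in unit_measure. h (Y k s) \<le> h (shift1 (f k) G c s)"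
    by (rule AE_mp, intro AE_I2 impI) (use Y[of k] opt in \<open>auto simp: admissible_def\<close>)
  moreover have "neat (shift1 (f k) G c)"
    using admissible_shift1[OF f[of k] G(1,2), of c] by (simp add: admissible_def)
  ultimately have "cube_prob (product_map Y) (\<lambda>x. x \<in> V) \<le>
      cube_prob (product_map (Y(k := shift1 (f k) G c))) (\<lambda>x. x \<in> V)"
    using V unfolding h_def by (intro cube_prob_update_le neat) auto
  with G show ?thesis by blast
qed

text \<open>Coordinates are replaced one after another. The result stays admissible, as the next
  replacement requires, and an update at \<open>k\<close> leaves earlier shifts intact.\<close>

lemma shift_dominates:
  fixes f :: "'n::finite \<Rightarrow> (real \<Rightarrow> real) \<times> (real \<Rightarrow> real)"
  assumes f: "\<And>k. f k \<in> B2" and V: "closed V" and Z: "\<And>k. admissible (f k) (Z k)"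
  shows "\<exists>G c. (\<forall>k. closed (G k) \<and> 0 \<in> G k \<and> c $ k \<in> {0..1}) \<and>
    cube_prob (product_map Z) (\<lambda>x. x \<in> V) \<le> cube_prob (shift2 f G c) (\<lambda>x. x \<in> V)"
proof -
  have "\<exists>Y. (\<forall>k. admissible (f k) (Y k)) \<and>
      cube_prob (product_map Z) (\<lambda>x. x \<in> V) \<le> cube_prob (product_map Y) (\<lambda>x. x \<in> V) \<and>
      (\<forall>k\<in>K. \<exists>G c. closed G \<and> 0 \<in> G \<and> c \<in> {0..1} \<and> Y k = shift1 (f k) G c)" for K :: "'n set"
    using finite[of K]
  proof (induction K rule: finite_induct)
    case empty
    then show ?case using Z by auto
  next
    case (insert k K)
    then obtain Y where Y: "\<And>k. admissible (f k) (Y k)"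
      and le: "cube_prob (product_map Z) (\<lambda>x. x \<in> V) \<le> cube_prob (product_map Y) (\<lambda>x. x \<in> V)"
      and K: "\<forall>k\<in>K. \<exists>G c. closed G \<and> 0 \<in> G \<and> c \<in> {0..1} \<and> Y k = shift1 (f k) G c"
      by blast
    have "\<exists>G c. closed G \<and> 0 \<in> G \<and> c \<in> {0..1} \<and>
        cube_prob (product_map Y) (\<lambda>x. x \<in> V) \<le>
        cube_prob (product_map (Y(k := shift1 (f k) G c))) (\<lambda>x. x \<in> V)"
      by (intro replace_by_shift f V Y)
    then obtain G c where G: "closed G" "0 \<in> G" "c \<in> {0..1}"
      and le': "cube_prob (product_map Y) (\<lambda>x. x \<in> V) \<le>
        cube_prob (product_map (Y(k := shift1 (f k) G c))) (\<lambda>x. x \<in> V)"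
      by blast
    show ?case
    proof (intro exI[of _ "Y(k := shift1 (f k) G c)"] conjI allI ballI)
      show "admissible (f j) ((Y(k := shift1 (f k) G c)) j)" for j
        using Y admissible_shift1[OF f G(1,2)] by simp
      show "cube_prob (product_map Z) (\<lambda>x. x \<in> V) \<le>
          cube_prob (product_map (Y(k := shift1 (f k) G c))) (\<lambda>x. x \<in> V)"
        using le le' by simp
      show "\<exists>G' c'. closed G' \<and> 0 \<in> G' \<and> c' \<in> {0..1} \<and>
          (Y(k := shift1 (f k) G c)) j = shift1 (f j) G' c'" if "j \<in> insert k K" for j
        using that K G by (cases "j = k") auto
    qed
  qed
  from this[of UNIV] obtain Y where
    le: "cube_prob (product_map Z) (\<lambda>x. x \<in> V) \<le> cube_prob (product_map Y) (\<lambda>x. x \<in> V)"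
    and "\<forall>k. \<exists>G c. closed G \<and> 0 \<in> G \<and> c \<in> {0..1} \<and> Y k = shift1 (f k) G c"
    by blast
  then obtain G c where G: "\<And>k. closed (G k) \<and> 0 \<in> G k \<and> c k \<in> {0..1}"
    and Y: "\<And>k. Y k = shift1 (f k) (G k) (c k)"
    by metis
  have "product_map Y = shift2 f G (\<chi> k. c k)"
    by (simp add: fun_eq_iff product_map_def shift2_def Y)
  then show ?thesis
    using G le by (intro exI[of _ G] exI[of _ "\<chi> k. c k"]) auto
qed

theorem theorem4p5p1:
  fixes f :: "'n::finite \<Rightarrow> (real \<Rightarrow> real) \<times> (real \<Rightarrow> real)"
    and V :: "(real^'n) set"
  assumes "\<forall>k. f k \<in> B2"
    and "closed V"
  shows "\<exists>(G :: 'n \<Rightarrow> real set) (c :: real^'n).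
           closed (set_product G) \<and> 0 \<in> set_product G \<and> (\<forall>k. c $ k \<in> {0..1}) \<and>
           (SUP X\<in>T2 f. cube_prob X (\<lambda>x. x \<in> V)) = cube_prob (shift2 f G c) (\<lambda>x. x \<in> V)"
proof -
  interpret C: prob_space "cube_measure :: (real^'n) measure" by (rule prob_space_cube_measure)
  define P where "P X = cube_prob X (\<lambda>x. x \<in> V)" for X :: "real^'n \<Rightarrow> real^'n"
  define M where "M = (SUP X\<in>T2 f. P X)"
  have f: "f k \<in> B2" for k using assms by simp
  have shift_T2: "shift2 f G c \<in> T2 f" if "\<And>k. closed (G k) \<and> 0 \<in> G k" for G c
    unfolding T2_iff[OF assms(1)]
    by (intro exI[of _ "\<lambda>k. shift1 (f k) (G k) (c $ k)"])
      (use that f in \<open>auto simp: product_map_def shift2_def intro: admissible_shift1\<close>)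
  \<comment> \<open>The shift with every factor equal to \<open>{0}\<close>, which vanishes on the
    cube, is a member.\<close>
  have ne: "T2 f \<noteq> {}"
    using shift_T2[of "\<lambda>_. {0}"] by auto
  have bdd: "bdd_above (P ` T2 f)"
    by (intro bdd_aboveI[of _ 1]) (auto simp: P_def cube_prob_def)
  \<comment> \<open>A maximizing sequence; \<open>Suc j\<close> avoids division by 0.\<close>
  have "\<exists>Y. (\<forall>k. admissible (f k) (Y k)) \<and> M - 1 / Suc j \<le> P (product_map Y)" for j
  proof -
    obtain X where X: "X \<in> T2 f" "M - 1 / Suc j < P X"
      using less_cSUP_iff[OF ne bdd, of "M - 1 / Suc j"] by (auto simp: M_def)
    then obtain Y where Y: "\<forall>k. admissible (f k) (Y k)" "\<forall>s\<in>open_cube. X s = product_map Y s"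
      using T2_iff[OF assms(1)] by blast
    have "P X = P (product_map Y)"
      unfolding P_def using Y(2) by (intro cube_prob_cong) auto
    then show ?thesis using X Y by auto
  qed
  then obtain Y where Y: "\<And>j k. admissible (f k) (Y j k)"
    and near: "\<And>j. M - 1 / Suc j \<le> P (product_map (Y j))"
    by metis
  have "(\<lambda>j. M - 1 / Suc j) \<longlonglongrightarrow> M - 0"
    by (intro tendsto_diff tendsto_const LIMSEQ_Suc[OF lim_1_over_n])
  then have "\<exists>Z. (\<forall>k. admissible (f k) (Z k)) \<and> M \<le> P (product_map Z)"
    using near unfolding P_def
    by (intro admissible_maximizer_exists[where Y = Y and a = "\<lambda>j. M - 1 / Suc j"] f assms(2) Y) auto
  then obtain Z where Z: "\<And>k. admissible (f k) (Z k)" "M \<le> P (product_map Z)"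
    by blast
  obtain G c where G: "\<And>k. closed (G k) \<and> 0 \<in> G k \<and> c $ k \<in> {0..1}"
    and le: "P (product_map Z) \<le> P (shift2 f G c)"
    using shift_dominates[where f = f and Z = Z, OF f assms(2) Z(1)] unfolding P_def by blast
  have "closed (set_product G)"
  proof -
    have "set_product G = (\<Inter>k. (\<lambda>x. x $ k) -` G k)"
      by (auto simp: set_product_def)
    then show ?thesis
      using G by (auto intro!: closed_INT closed_vimage_vec_nth)
  qed
  \<comment> \<open>The shift dominates a maximizer and is itself a member of
    \<open>T2 f\<close>.\<close>
  moreover have "M = P (shift2 f G c)"
  proof (rule antisym)
    show "P (shift2 f G c) \<le> M"
      unfolding M_def using G by (intro cSUP_upper bdd shift_T2) auto
  qed (use Z le in simp)
  ultimately show ?thesis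
    using G by (intro exI[of _ G] exI[of _ c]) (auto simp: set_product_def M_def P_def)
qed

end
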